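(* Let $(G,u)$ be an Abelian unital $\ell$-group and suppose that the MV-algebra $M=\Gamma(G,u)$ has a strict square root $r$. Then for each $x\in M$ the element $(x+u)/2$ is defined in $G$ (i.e. there is a, necessarily unique, $g\in G$ with $g+g=x+u$), and $$r(x)=(x+u)/2,\qquad x\in M,$$ where $+$ denotes the group addition in $G$.
   Context: A unital $\ell$-group $(G,u)$ is an Abelian lattice-ordered group $G$ with a fixed strong unit $u\ge 0$ (for each $g\in G$ there is an integer $n\ge1$ with $g\le nu$). $\Gamma(G,u)=([0,u];\oplus,',0,u)$ is the MV-algebra on the interval $[0,u]$ with $x\oplus y=(x+y)\wedge u$, $x'=u-x$; its order is that of $G$, and $x\odot y=(x'\oplus y')'$. A square root on an MV-algebra $M$ is a map $r:M\to M$ such that $r(x)\odot r(x)=x$ for all $x\in M$, and for all $x,y\in M$, $y\odot y\le x$ implies $y\le r(x)$. It is strict if $r(0)=r(0)'$. Abelian $\ell$-groups have unique extraction of roots; $g/2$ denotes the unique $h$ with $h+h=g$, if it exists. *)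

theory Defs
  imports "HOL-Library.Lattice_Algebras" "HOL-Library.FuncSet"
begin

record 'a mv_struct =
  mv_carrier :: "'a set"
  mv_oplus :: "'a \<Rightarrow> 'a \<Rightarrow> 'a"
  mv_compl :: "'a \<Rightarrow> 'a"
  mv_zero :: 'a
  mv_one :: 'a

locale mv_algebra =
  fixes M :: "'a mv_struct"
  assumes oplus_closed: "\<lbrakk>x \<in> mv_carrier M; y \<in> mv_carrier M\<rbrakk> \<Longrightarrow> mv_oplus M x y \<in> mv_carrier M"
    and compl_closed: "x \<in> mv_carrier M \<Longrightarrow> mv_compl M x \<in> mv_carrier M"
    and zero_closed: "mv_zero M \<in> mv_carrier M"
    and one_closed: "mv_one M \<in> mv_carrier M"
    and oplus_assoc: "\<lbrakk>x \<in> mv_carrier M; y \<in> mv_carrier M; z \<in> mv_carrier M\<rbrakk> \<Longrightarrow>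
      mv_oplus M (mv_oplus M x y) z = mv_oplus M x (mv_oplus M y z)"
    and oplus_commute: "\<lbrakk>x \<in> mv_carrier M; y \<in> mv_carrier M\<rbrakk> \<Longrightarrow>
      mv_oplus M x y = mv_oplus M y x"
    and oplus_zero: "x \<in> mv_carrier M \<Longrightarrow> mv_oplus M x (mv_zero M) = x"
    and oplus_one: "x \<in> mv_carrier M \<Longrightarrow> mv_oplus M x (mv_one M) = mv_one M"
    and compl_compl: "x \<in> mv_carrier M \<Longrightarrow> mv_compl M (mv_compl M x) = x"
    and compl_zero: "mv_compl M (mv_zero M) = mv_one M"
    and lukasiewicz: "\<lbrakk>x \<in> mv_carrier M; y \<in> mv_carrier M\<rbrakk> \<Longrightarrow>
      mv_oplus M (mv_compl M (mv_oplus M (mv_compl M x) y)) y =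
      mv_oplus M (mv_compl M (mv_oplus M (mv_compl M y) x)) x"

definition mv_odot :: "'a mv_struct \<Rightarrow> 'a \<Rightarrow> 'a \<Rightarrow> 'a" where
  "mv_odot M x y = mv_compl M (mv_oplus M (mv_compl M x) (mv_compl M y))"

text \<open>The natural order of an MV-algebra; for the algebras \<open>Gamma u\<close> below it is the order
  of the group, see \<open>Gamma_le_iff\<close>.\<close>

definition mv_le :: "'a mv_struct \<Rightarrow> 'a \<Rightarrow> 'a \<Rightarrow> bool" where
  "mv_le M x y \<longleftrightarrow> mv_oplus M (mv_compl M x) y = mv_one M"

text \<open>A map on the carrier is represented by a function on the whole type whose values
  outside the carrier are irrelevant.\<close>

definition mv_square_root :: "'a mv_struct \<Rightarrow> ('a \<Rightarrow> 'a) \<Rightarrow> bool" where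
  "mv_square_root M r \<longleftrightarrow>
     r \<in> mv_carrier M \<rightarrow> mv_carrier M \<and>
     (\<forall>x\<in>mv_carrier M. mv_odot M (r x) (r x) = x) \<and>
     (\<forall>x\<in>mv_carrier M. \<forall>y\<in>mv_carrier M. mv_le M (mv_odot M y y) x \<longrightarrow> mv_le M y (r x))"

definition mv_strict_square_root :: "'a mv_struct \<Rightarrow> ('a \<Rightarrow> 'a) \<Rightarrow> bool" where
  "mv_strict_square_root M r \<longleftrightarrow>
     mv_square_root M r \<and> r (mv_zero M) = mv_compl M (r (mv_zero M))"

text \<open>The sum \<open>\<Sum>i<n. u\<close> is the multiple \<open>n u\<close>.\<close>

definition strong_unit :: "'a::lattice_ab_group_add \<Rightarrow> bool" where
  "strong_unit u \<longleftrightarrow> 0 \<le> u \<and> (\<forall>g. \<exists>n::nat. 1 \<le> n \<and> g \<le> (\<Sum>i<n. u))"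

definition Gamma :: "'a::lattice_ab_group_add \<Rightarrow> 'a mv_struct" where
  "Gamma u = \<lparr>mv_carrier = {0..u}, mv_oplus = (\<lambda>x y. inf (x + y) u),
     mv_compl = (\<lambda>x. u - x), mv_zero = 0, mv_one = u\<rparr>"

text \<open>Meaningful only if \<open>g\<close> is divisible by two; the half is then unique.\<close>

definition half :: "'a::lattice_ab_group_add \<Rightarrow> 'a" where
  "half g = (THE h. h + h = g)"

lemma Gamma_le_iff:
  fixes u :: "'a::lattice_ab_group_add"
  shows "mv_le (Gamma u) x y \<longleftrightarrow> x \<le> y"
proof -
  have "inf (u - x + y) u = u \<longleftrightarrow> u \<le> u - x + y"
    by (simp add: inf.absorb_iff2)
  also have "\<dots> \<longleftrightarrow> x \<le> y"
    by (simp add: algebra_simps)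
  finally show ?thesis by (simp add: mv_le_def Gamma_def)
qed

lemma trunc_add:
  fixes u x z :: "'a::lattice_ab_group_add"
  assumes "0 \<le> z"
  shows "inf (inf x u + z) u = inf (x + z) u"
proof -
  have "inf (inf x u + z) u = inf (x + z) (inf (u + z) u)"
    by (simp add: add_inf_distrib_right inf.assoc)
  also have "inf (u + z) u = u" using assms by (simp add: inf.absorb2)
  finally show ?thesis .
qed

lemma Gamma_sup:
  fixes u x y :: "'a::lattice_ab_group_add"
  assumes "x \<le> u" "y \<le> u"
  shows "inf (u - inf (u - x + y) u + y) u = sup x y"
proof -
  have "inf (u - x + y) u = u + inf (y - x) 0"
    using add_inf_distrib_left[of u "y - x" 0] by (simp add: algebra_simps)
  then have "u - inf (u - x + y) u + y = - inf (y - x) 0 + y"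
    by (simp only: diff_conv_add_uminus minus_add_distrib) simp
  also have "- inf (y - x) 0 + y = sup (x - y) 0 + y"
    by (simp add: neg_inf_eq_sup)
  also have "\<dots> = sup x y" by (simp add: add_sup_distrib_right)
  finally show ?thesis using assms by (simp add: inf.absorb1)
qed

lemma mv_algebra_Gamma:
  fixes u :: "'a::lattice_ab_group_add"
  assumes "0 \<le> u"
  shows "mv_algebra (Gamma u)"
proof
  fix x y z :: 'a
  assume "x \<in> mv_carrier (Gamma u)" "y \<in> mv_carrier (Gamma u)" "z \<in> mv_carrier (Gamma u)"
  then have "0 \<le> x" "0 \<le> z" by (simp_all add: Gamma_def)
  then show "mv_oplus (Gamma u) (mv_oplus (Gamma u) x y) z =
      mv_oplus (Gamma u) x (mv_oplus (Gamma u) y z)"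
    using trunc_add[of z "x + y" u] trunc_add[of x "y + z" u]
    by (simp add: Gamma_def algebra_simps)
next
  fix x y :: 'a
  assume "x \<in> mv_carrier (Gamma u)" "y \<in> mv_carrier (Gamma u)"
  then have "x \<le> u" "y \<le> u" by (simp_all add: Gamma_def)
  with Gamma_sup[of x u y] Gamma_sup[of y u x]
  show "mv_oplus (Gamma u) (mv_compl (Gamma u) (mv_oplus (Gamma u) (mv_compl (Gamma u) x) y)) y =
      mv_oplus (Gamma u) (mv_compl (Gamma u) (mv_oplus (Gamma u) (mv_compl (Gamma u) y) x)) x"
    by (simp only: Gamma_def mv_struct.simps sup.commute)
qed (use assms in \<open>auto simp: Gamma_def add.commute inf.absorb1 inf.absorb2\<close>)

end

theory Submission
  imports Defs
begin

text \<open>Strictness says that \<open>h = r 0\<close> satisfies \<open>h + h = u\<close>. Then \<open>h \<odot> h = 0 \<le> x\<close>, so maximality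
  of the square root gives \<open>h \<le> r x\<close>, that is, \<open>u \<le> r x + r x\<close>. The truncation at \<open>0\<close> in
  \<open>r x \<odot> r x = sup (r x + r x - u) 0\<close> is therefore inactive, and \<open>r x \<odot> r x = x\<close> reads
  \<open>r x + r x = x + u\<close>.\<close>

text \<open>Lattice-ordered groups have no 2-torsion: \<open>d + d = 0\<close> forces
  \<open>d = 0\<close>, here for \<open>d = g - h\<close>.\<close>

lemma double_inject:
  fixes g h :: "'a::lattice_ab_group_add"
  assumes "g + g = h + h"
  shows "g = h"
proof -
  have "(g - h) + (g - h) = 0"
    using assms by (simp add: algebra_simps)
  then show ?thesis by simp
qed

lemma half_eqI:
  fixes g h :: "'a::lattice_ab_group_add"
  assumes "h + h = g"
  shows "half g = h"
  unfolding half_def using assms by (blast intro: double_inject)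

text \<open>The complement \<open>u - _\<close> reverses the order, so it turns the truncation from
  above at \<open>u\<close> in the sum into a truncation from below at \<open>0\<close>.\<close>

lemma Gamma_odot_self:
  fixes u y :: "'a::lattice_ab_group_add"
  shows "mv_odot (Gamma u) y y = sup (y + y - u) 0"
proof -
  have "mv_odot (Gamma u) y y = u + - inf (u - y + (u - y)) u"
    by (simp add: mv_odot_def Gamma_def)
  also have "\<dots> = sup (u + - (u - y + (u - y))) (u + - u)"
    by (simp only: neg_inf_eq_sup add_sup_distrib_left)
  also have "\<dots> = sup (y + y - u) 0"
    by (simp add: algebra_simps)
  finally show ?thesis .
qed

theorem theorem5p14:
  fixes u :: "'a::lattice_ab_group_add"
    and r :: "'a \<Rightarrow> 'a"
  assumes "strong_unit u"
    and "mv_strict_square_root (Gamma u) r"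
  shows "\<forall>x\<in>mv_carrier (Gamma u). (\<exists>!g. g + g = x + u) \<and> r x = half (x + u)"
proof
  fix x assume x: "x \<in> mv_carrier (Gamma u)"
  then have "0 \<le> x" by (simp add: Gamma_def)
  from assms have "0 \<le> u"
    by (simp add: strong_unit_def)
  then have zero: "0 \<in> mv_carrier (Gamma u)"
    by (simp add: Gamma_def)
  from assms have root: "mv_square_root (Gamma u) r" and "r 0 = u - r 0"
    by (simp_all add: mv_strict_square_root_def Gamma_def)
  then have h: "r 0 + r 0 = u"
    by (simp add: eq_diff_eq)
  from root zero have "r 0 \<in> mv_carrier (Gamma u)"
    by (auto simp: mv_square_root_def)
  moreover have "mv_odot (Gamma u) (r 0) (r 0) \<le> x"
    using h \<open>0 \<le> x\<close> by (simp add: Gamma_odot_self)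
  ultimately have "r 0 \<le> r x"
    using root x by (simp add: mv_square_root_def Gamma_le_iff)
  then have "u \<le> r x + r x"
    using add_mono[of "r 0" "r x" "r 0" "r x"] h by simp
  moreover have "sup (r x + r x - u) 0 = x"
    using root x by (simp add: mv_square_root_def Gamma_odot_self)
  ultimately have "r x + r x - u = x"
    by (simp add: sup.absorb1)
  then have "r x + r x = x + u"
    by (simp add: diff_eq_eq)
  \<comment> \<open>The witness is \<open>r x\<close> itself, and cancelling doubles makes it
    unique.\<close>
  then show "(\<exists>!g. g + g = x + u) \<and> r x = half (x + u)"
    by (metis double_inject half_eqI)
qed

end
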